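(* For any $z\in\mathbb{C}$, we have $$\frac{1}{2}(e^{2z}-1) = \mathop{\mathcal{R}}_{n=1}^{\infty}\left(z+\frac{z^2}{2^n}\right),$$ $$\sin\left(\frac{2z}{\sqrt{3}}+\frac{\pi}{6}\right)-\frac{1}{2} = \mathop{\mathcal{R}}_{n=1}^{\infty}\left(z+\frac{z^2}{(-2)^n}\right),$$ $$\left(\sinh\sqrt{z}\right)^2 = \mathop{\mathcal{R}}_{n=1}^{\infty}\left(z+\frac{z^2}{4^n}\right).$$
   Context: For integers $N\ge d$ and functions $f_d,\ldots,f_N$, the finite composition is $\mathop{\mathcal{R}}_{n=d}^{N} f_n(z) := f_d(f_{d+1}(\cdots f_{N-1}(f_N(z))\cdots))$ (the function with the largest index is applied first). The infinite composition is $\mathop{\mathcal{R}}_{n=1}^{\infty} f_n(z) := \lim_{N\to\infty}\mathop{\mathcal{R}}_{n=1}^{N} f_n(z)$; the equalities include the assertion that this limit exists. The value $(\sinh\sqrt{z})^2$ does not depend on the choice of square root of $z$. *)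

theory Defs
  imports Complex_Main
begin

(* finite_comp f d N = f d o f (d+1) o ... o f N, so f N is applied first;
   it is the identity for N < d, a case that does not affect limits in N. *)
definition finite_comp :: "(nat \<Rightarrow> 'a \<Rightarrow> 'a) \<Rightarrow> nat \<Rightarrow> nat \<Rightarrow> 'a \<Rightarrow> 'a" where
  "finite_comp f d N = foldr (\<circ>) (map f [d..<Suc N]) id"

definition infinite_comp_converges ::
    "(nat \<Rightarrow> 'a \<Rightarrow> 'a::topological_space) \<Rightarrow> nat \<Rightarrow> 'a \<Rightarrow> bool" where
  "infinite_comp_converges f d z \<longleftrightarrow> convergent (\<lambda>N. finite_comp f d N z)"

(* Only meaningful together with infinite_comp_converges, since lim is
   a total function with an unspecified value on divergent sequences. *)
definition infinite_comp ::
    "(nat \<Rightarrow> 'a \<Rightarrow> 'a::t2_space) \<Rightarrow> nat \<Rightarrow> 'a \<Rightarrow> 'a" where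
  "infinite_comp f d z = lim (\<lambda>N. finite_comp f d N z)"

end

theory Submission
  imports Defs
begin

text \<open>
  Let \<open>f\<^sub>n w = w + w\<^sup>2 / q^n\<close> with \<open>\<bar>q\<bar> \<ge> 2\<close>, and let \<open>F\<close> satisfy \<open>F 0 = 0\<close>, \<open>F' 0 = 1\<close> and the
  functional equation \<open>F (q w) = q (F w + (F w)\<^sup>2)\<close>. The rescalings \<open>g\<^sub>n = q^n F (z / q^n)\<close> form a
  backward orbit, \<open>f\<^sub>n g\<^sub>n = g\<^bsub>n-1\<^esub>\<close>, so \<open>f\<^sub>1 (f\<^sub>2 (\<dots> (f\<^sub>N g\<^sub>N))) = g\<^sub>0 = F z\<close> for every \<open>N\<close>, while
  \<open>g\<^sub>N \<longlonglongrightarrow> F' 0 z = z\<close>. It remains to replace the argument \<open>g\<^sub>N\<close> by its limit \<open>z\<close>, and for this it is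
  enough that the compositions are Lipschitz near \<open>z\<close> with a constant independent of \<open>N\<close>.

  That constant comes from the extremal case \<open>q = 2\<close> itself: for \<open>x > 0\<close> the positive numbers
  \<open>h\<^sub>n = 2^n (exp (2 x / 2^n) - 1) / 2\<close> are a backward orbit for \<open>q = 2\<close>, so by the triangle
  inequality \<open>f\<^sub>n\<close> maps the disc of radius \<open>h\<^sub>n\<close> into the disc of radius \<open>h\<^bsub>n-1\<^esub>\<close>. On the former disc its
  Lipschitz constant is at most \<open>1 + 2 h\<^sub>n / 2^n = exp (2 x / 2^n)\<close>, and the product of these constants
  is at most \<open>exp (2 x)\<close> (lemma \<open>quadratic_comp_lipschitz\<close>).

  The three identities are then the duplication formulas of \<open>exp\<close>, \<open>sin\<close> and \<open>sinh\<close>.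
\<close>

section \<open>Compositions along backward orbits\<close>

lemma finite_comp_Suc:
  assumes "d \<le> Suc N"
  shows "finite_comp f d (Suc N) z = finite_comp f d N (f (Suc N) z)"
proof -
  have foldr_comp: "foldr (\<circ>) fs g = foldr (\<circ>) fs id \<circ> g" for fs and g :: "'a \<Rightarrow> 'a"
    by (induction fs) (simp_all add: comp_assoc)
  show ?thesis
    using assms foldr_comp[of _ "f (Suc N)"] by (simp add: finite_comp_def)
qed

lemma finite_comp_backward_orbit:
  assumes "\<And>n. f (Suc n) (g (Suc n)) = g n"
  shows "finite_comp f 1 N (g N) = g 0"
proof (induction N)
  case 0
  show ?case by (simp add: finite_comp_def)
next
  case (Suc N)
  then show ?case using assms by (simp add: finite_comp_Suc)
qed

section \<open>A Lipschitz bound uniform in the number of factors\<close>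

definition exp_radius :: "real \<Rightarrow> nat \<Rightarrow> real" where
  "exp_radius x n = 2 ^ n * (exp (2 * x / 2 ^ n) - 1) / 2"

lemma exp_radius_ge: "x \<le> exp_radius x n"
proof -
  have "1 + 2 * x / 2 ^ n \<le> exp (2 * x / 2 ^ n)"
    by (rule exp_ge_add_one_self)
  then show ?thesis
    by (simp add: exp_radius_def field_simps)
qed

lemma exp_radius_backward_orbit:
  "exp_radius x (Suc n) + exp_radius x (Suc n) ^ 2 / 2 ^ Suc n = exp_radius x n"
proof -
  define e where "e = exp (2 * x / 2 ^ Suc n)"
  have "exp (2 * x / 2 ^ n) = exp (2 * (2 * x / 2 ^ Suc n))"
    by simp
  also have "\<dots> = e ^ 2"
    unfolding e_def by (rule exp_double)
  finally have "exp (2 * x / 2 ^ n) = e ^ 2" .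
  then show ?thesis
    unfolding exp_radius_def e_def[symmetric]
    by (simp add: field_simps power2_eq_square)
qed

text \<open>
  Each step maps the disc of one radius into the disc of the preceding one, so the Lipschitz constants multiply;
  the exponents form the geometric series \<open>\<Sum>n=1..N. 2 x / 2^n = 2 x (1 - 1 / 2^N)\<close>.
\<close>
lemma quadratic_comp_lipschitz:
  fixes q w v :: "'a :: real_normed_field"
  assumes q: "2 \<le> norm q" and "0 \<le> x"
    and "norm w \<le> exp_radius x N" "norm v \<le> exp_radius x N"
  defines "f \<equiv> (\<lambda>n w. w + w ^ 2 / q ^ n)"
  shows "norm (finite_comp f 1 N w - finite_comp f 1 N v)
          \<le> exp (2 * x * (1 - 1 / 2 ^ N)) * norm (w - v)"
  using assms(3,4)
proof (induction N arbitrary: w v)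
  case 0
  show ?case by (simp add: finite_comp_def)
next
  case (Suc N)
  define r where "r = exp_radius x (Suc N)"
  define Q :: real where "Q = 2 ^ Suc N"
  have r: "norm w \<le> r" "norm v \<le> r" "0 \<le> r"
    using Suc.prems exp_radius_ge[of x "Suc N"] \<open>0 \<le> x\<close> by (auto simp: r_def)
  have "0 < Q" and Q: "Q \<le> norm (q ^ Suc N)"
    using power_mono[OF q, of "Suc N"] by (simp_all add: Q_def norm_power norm_mult)
  have radius: "norm (f (Suc N) u) \<le> exp_radius x N" if "norm u \<le> r" for u
  proof -
    have "norm (f (Suc N) u) \<le> norm u + norm (u ^ 2) / norm (q ^ Suc N)"
      unfolding f_def by (metis norm_triangle_ineq norm_divide)
    also have "\<dots> \<le> r + r ^ 2 / Q"
      using that \<open>0 < Q\<close> Q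
      by (intro add_mono frac_le) (auto simp: norm_power power_mono)
    also have "\<dots> = exp_radius x N"
      unfolding r_def Q_def by (rule exp_radius_backward_orbit)
    finally show ?thesis .
  qed
  have "f (Suc N) w - f (Suc N) v = (w - v) * (1 + (w + v) / q ^ Suc N)"
    by (simp add: f_def algebra_simps power2_eq_square add_divide_distrib diff_divide_distrib)
  then have "norm (f (Suc N) w - f (Suc N) v) = norm (w - v) * norm (1 + (w + v) / q ^ Suc N)"
    by (simp add: norm_mult)
  also have "\<dots> \<le> norm (w - v) * (1 + 2 * r / Q)"
  proof (rule mult_left_mono)
    have "norm (1 + (w + v) / q ^ Suc N) \<le> 1 + norm (w + v) / norm (q ^ Suc N)"
      by (metis norm_triangle_ineq norm_divide norm_one)
    also have "\<dots> \<le> 1 + 2 * r / Q"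
      using norm_triangle_ineq[of w v] r \<open>0 < Q\<close> Q by (intro add_mono frac_le) auto
    finally show "norm (1 + (w + v) / q ^ Suc N) \<le> 1 + 2 * r / Q" .
  qed simp
  also have "1 + 2 * r / Q = exp (2 * x / Q)"
    by (simp add: r_def Q_def exp_radius_def)
  finally have step: "norm (f (Suc N) w - f (Suc N) v) \<le> exp (2 * x / Q) * norm (w - v)"
    by (simp add: mult.commute)
  have "norm (finite_comp f 1 (Suc N) w - finite_comp f 1 (Suc N) v)
      \<le> exp (2 * x * (1 - 1 / 2 ^ N)) * norm (f (Suc N) w - f (Suc N) v)"
    using Suc.IH radius r by (simp add: finite_comp_Suc)
  also have "\<dots> \<le> exp (2 * x * (1 - 1 / 2 ^ N)) * (exp (2 * x / Q) * norm (w - v))"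
    using step by simp
  also have "\<dots> = exp (2 * x * (1 - 1 / 2 ^ N) + 2 * x / Q) * norm (w - v)"
    by (simp add: exp_add)
  also have "2 * x * (1 - 1 / 2 ^ N) + 2 * x / Q = 2 * x * (1 - 1 / 2 ^ Suc N)"
    by (simp add: Q_def field_simps)
  finally show ?case .
qed

text \<open>
  A convergent backward orbit is bounded, so it lies together with its limit in the discs on which the
  Lipschitz bound holds uniformly in \<open>N\<close>.
\<close>
lemma quadratic_comp_tendsto_backward_orbit:
  fixes q z :: "'a :: real_normed_field"
  assumes q: "2 \<le> norm q"
    and orbit: "\<And>n. g (Suc n) + g (Suc n) ^ 2 / q ^ Suc n = g n"
    and lim: "g \<longlonglongrightarrow> z"
  shows "(\<lambda>N. finite_comp (\<lambda>n w. w + w ^ 2 / q ^ n) 1 N z) \<longlonglongrightarrow> g 0"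
proof -
  define f where "f = (\<lambda>n w. w + w ^ 2 / q ^ n)"
  have "Bseq g"
    using lim by (blast intro: convergent_imp_Bseq convergentI)
  then obtain K where "0 < K" and K: "\<And>n. norm (g n) \<le> K"
    by (auto simp: Bseq_def)
  define x where "x = K + norm z"
  have x: "0 \<le> x" "norm (g n) \<le> exp_radius x n" "norm z \<le> exp_radius x n" for n
    using \<open>0 < K\<close> K[of n] exp_radius_ge[of x n] norm_ge_zero[of z]
    unfolding x_def by linarith+
  have bound: "norm (finite_comp f 1 N z - g 0) \<le> exp (2 * x) * norm (z - g N)" for N
  proof -
    have "finite_comp f 1 N (g N) = g 0"
      using orbit by (intro finite_comp_backward_orbit) (simp add: f_def)
    then have "norm (finite_comp f 1 N z - g 0)
        \<le> exp (2 * x * (1 - 1 / 2 ^ N)) * norm (z - g N)"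
      using quadratic_comp_lipschitz[OF q x(1) x(3) x(2), of N] by (simp add: f_def)
    also have "\<dots> \<le> exp (2 * x) * norm (z - g N)"
      using x(1) by (intro mult_right_mono) (simp_all add: mult_left_le)
    finally show ?thesis .
  qed
  have "(\<lambda>N. exp (2 * x) * norm (z - g N)) \<longlonglongrightarrow> exp (2 * x) * norm (z - z)"
    by (intro tendsto_intros lim)
  then have "(\<lambda>N. exp (2 * x) * norm (z - g N)) \<longlonglongrightarrow> 0"
    by simp
  then have "(\<lambda>N. finite_comp f 1 N z - g 0) \<longlonglongrightarrow> 0"
    by (rule tendsto_0_le[where K = 1]) (use bound in simp)
  then show ?thesis
    by (simp add: f_def LIM_zero_iff)
qed

section \<open>Limits from functional equations\<close>

lemma rescaling_tendsto_derivative: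
  fixes F :: "'a :: real_normed_field \<Rightarrow> 'a"
  assumes "1 < norm q" and "F 0 = 0" and deriv: "(F has_field_derivative D) (at 0)"
  shows "(\<lambda>n. q ^ n * F (z / q ^ n)) \<longlonglongrightarrow> D * z"
proof (cases "z = 0")
  case True
  then show ?thesis using \<open>F 0 = 0\<close> by simp
next
  case False
  have "q \<noteq> 0" using assms(1) by auto
  have "(\<lambda>n. inverse q ^ n) \<longlonglongrightarrow> 0"
    using assms(1) by (intro LIMSEQ_power_zero) (simp add: norm_inverse inverse_less_1_iff)
  then have "(\<lambda>n. z * inverse q ^ n) \<longlonglongrightarrow> z * 0"
    by (rule tendsto_mult_left)
  then have "(\<lambda>n. z / q ^ n) \<longlonglongrightarrow> 0"
    by (simp add: divide_inverse power_inverse)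
  then have "filterlim (\<lambda>n. z / q ^ n) (at 0) sequentially"
    using False \<open>q \<noteq> 0\<close> by (auto simp: filterlim_at)
  moreover have "((\<lambda>u. F u / u) \<longlongrightarrow> D) (at 0)"
    using deriv \<open>F 0 = 0\<close> by (simp add: has_field_derivative_iff)
  ultimately have "(\<lambda>n. F (z / q ^ n) / (z / q ^ n)) \<longlonglongrightarrow> D"
    by (rule filterlim_compose[rotated])
  then have "(\<lambda>n. F (z / q ^ n) / (z / q ^ n) * z) \<longlonglongrightarrow> D * z"
    by (intro tendsto_intros)
  moreover have "F (z / q ^ n) / (z / q ^ n) * z = q ^ n * F (z / q ^ n)" for n
    using False by simp
  ultimately show ?thesis by simp
qed

lemma quadratic_comp_tendsto_functional_equation:
  fixes F :: "'a :: real_normed_field \<Rightarrow> 'a"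
  assumes q: "2 \<le> norm q"
    and eq: "\<And>w. F (q * w) = q * (F w + F w ^ 2)"
    and "F 0 = 0" and deriv: "(F has_field_derivative 1) (at 0)"
  shows "(\<lambda>N. finite_comp (\<lambda>n w. w + w ^ 2 / q ^ n) 1 N z) \<longlonglongrightarrow> F z"
proof -
  define g where "g = (\<lambda>n. q ^ n * F (z / q ^ n))"
  have "q \<noteq> 0" using q by auto
  have "g \<longlonglongrightarrow> z"
    using rescaling_tendsto_derivative[OF _ \<open>F 0 = 0\<close> deriv, of q z] q by (simp add: g_def)
  moreover have "g (Suc n) + g (Suc n) ^ 2 / q ^ Suc n = g n" for n
  proof -
    define w where "w = z / q ^ Suc n"
    have "g n = q ^ n * F (q * w)"
      using \<open>q \<noteq> 0\<close> by (simp add: g_def w_def)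
    also have "\<dots> = q ^ Suc n * F w + (q ^ Suc n * F w) ^ 2 / q ^ Suc n"
      using \<open>q \<noteq> 0\<close> by (simp add: eq field_simps power2_eq_square)
    finally show ?thesis
      by (simp add: g_def w_def)
  qed
  ultimately have "(\<lambda>N. finite_comp (\<lambda>n w. w + w ^ 2 / q ^ n) 1 N z) \<longlonglongrightarrow> g 0"
    using quadratic_comp_tendsto_backward_orbit[OF q] by blast
  then show ?thesis by (simp add: g_def)
qed

section \<open>The exponential, sine and hyperbolic sine\<close>

lemma quadratic_comp_tendsto_exp:
  fixes z :: complex
  shows "(\<lambda>N. finite_comp (\<lambda>n w. w + w ^ 2 / 2 ^ n) 1 N z) \<longlonglongrightarrow> 1 / 2 * (exp (2 * z) - 1)"
proof (rule quadratic_comp_tendsto_functional_equation)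
  fix w :: complex
  show "1 / 2 * (exp (2 * (2 * w)) - 1)
      = 2 * (1 / 2 * (exp (2 * w) - 1) + (1 / 2 * (exp (2 * w) - 1)) ^ 2)"
    unfolding exp_double[of "2 * w"] by (simp add: field_simps power2_eq_square)
  show "((\<lambda>z. 1 / 2 * (exp (2 * z) - 1)) has_field_derivative (1 :: complex)) (at 0)"
    by (auto intro!: derivative_eq_intros)
qed simp_all

lemma quadratic_comp_tendsto_sin:
  fixes z :: complex
  shows "(\<lambda>N. finite_comp (\<lambda>n w. w + w ^ 2 / (- 2) ^ n) 1 N z)
          \<longlonglongrightarrow> sin (2 * z / of_real (sqrt 3) + of_real pi / 6) - 1 / 2"
proof (rule quadratic_comp_tendsto_functional_equation)
  have "sin (of_real (pi / 6) :: complex) = of_real (sin (pi / 6))"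
    by (rule sin_of_real)
  then have sin30: "sin (of_real pi / 6 :: complex) = 1 / 2"
    by (simp add: sin_30)
  have "cos (of_real (pi / 6) :: complex) = of_real (cos (pi / 6))"
    by (rule cos_of_real)
  then have cos30: "cos (of_real pi / 6 :: complex) = of_real (sqrt 3) / 2"
    by (simp add: cos_30)
  fix w :: complex
  define t where "t = 2 * w / of_real (sqrt 3) + of_real pi / 6"
  \<comment> \<open>\<open>pi / 6\<close> is the phase for which multiplying \<open>w\<close> by \<open>-2\<close> turns \<open>sin t\<close> into \<open>cos (2 t)\<close>.\<close>
  have "2 * (- 2 * w) / of_real (sqrt 3) + of_real pi / 6 = of_real pi / 2 - 2 * t"
    by (simp add: t_def field_simps)
  then have "sin (2 * (- 2 * w) / of_real (sqrt 3) + of_real pi / 6) = cos (2 * t)"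
    by (simp add: sin_diff)
  also have "\<dots> = 1 - 2 * sin t ^ 2"
    by (rule cos_double_sin)
  finally have "sin (2 * (- 2 * w) / of_real (sqrt 3) + of_real pi / 6) = 1 - 2 * sin t ^ 2" .
  moreover have "1 - 2 * sin t ^ 2 - 1 / 2 = - 2 * (sin t - 1 / 2 + (sin t - 1 / 2) ^ 2)"
    by (simp add: field_simps power2_eq_square)
  ultimately show "sin (2 * (- 2 * w) / of_real (sqrt 3) + of_real pi / 6) - 1 / 2
      = - 2 * (sin (2 * w / of_real (sqrt 3) + of_real pi / 6) - 1 / 2
                + (sin (2 * w / of_real (sqrt 3) + of_real pi / 6) - 1 / 2) ^ 2)"
    by (simp only: t_def)
  show "sin (2 * 0 / of_real (sqrt 3) + of_real pi / 6) - 1 / 2 = (0 :: complex)"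
    by (simp add: sin30)
  show "((\<lambda>z. sin (2 * z / of_real (sqrt 3) + of_real pi / 6) - 1 / 2)
      has_field_derivative (1 :: complex)) (at 0)"
    by (auto intro!: derivative_eq_intros simp: cos30)
qed simp

text \<open>
  Here the backward orbit is the square of the rescaled \<open>sinh\<close> at a fixed square root \<open>s\<close> of the
  argument; this avoids differentiating a square root at its branch point.
\<close>
lemma quadratic_comp_tendsto_sinh:
  fixes s :: complex
  shows "(\<lambda>N. finite_comp (\<lambda>n w. w + w ^ 2 / 4 ^ n) 1 N (s ^ 2)) \<longlonglongrightarrow> sinh s ^ 2"
proof -
  define g where "g = (\<lambda>n. (2 ^ n * sinh (s / 2 ^ n)) ^ 2)"
  have "(sinh has_field_derivative (1 :: complex)) (at 0)"
    by (auto intro!: derivative_eq_intros)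
  then have "(\<lambda>n. 2 ^ n * sinh (s / 2 ^ n)) \<longlonglongrightarrow> 1 * s"
    by (intro rescaling_tendsto_derivative[where F = sinh]) simp_all
  then have "g \<longlonglongrightarrow> (1 * s) ^ 2"
    unfolding g_def by (rule tendsto_power)
  then have lim: "g \<longlonglongrightarrow> s ^ 2" by simp
  have orbit: "g (Suc n) + g (Suc n) ^ 2 / 4 ^ Suc n = g n" for n
  proof -
    define t where "t = s / 2 ^ Suc n"
    have pow4: "(4 :: complex) ^ n = (2 ^ n) ^ 2" for n
      by (simp add: power2_eq_square flip: power_mult_distrib)
    have "sinh (s / 2 ^ n) = sinh (2 * t)"
      by (simp add: t_def)
    then have "g n = (2 ^ n) ^ 2 * (4 * sinh t ^ 2 * cosh t ^ 2)"
      by (simp add: g_def sinh_double power_mult_distrib)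
    also have "\<dots> = (2 ^ n) ^ 2 * (4 * sinh t ^ 2 * (sinh t ^ 2 + 1))"
      by (simp add: cosh_square_eq)
    also have "\<dots> = (2 ^ Suc n * sinh t) ^ 2 + ((2 ^ Suc n * sinh t) ^ 2) ^ 2 / 4 ^ Suc n"
      by (simp add: pow4 field_simps power2_eq_square)
    finally show ?thesis
      by (simp add: g_def t_def)
  qed
  have "(\<lambda>N. finite_comp (\<lambda>n w. w + w ^ 2 / 4 ^ n) 1 N (s ^ 2)) \<longlonglongrightarrow> g 0"
    by (rule quadratic_comp_tendsto_backward_orbit[OF _ orbit lim]) simp
  then show ?thesis by (simp add: g_def)
qed

lemma infinite_comp_eqI:
  assumes "(\<lambda>N. finite_comp f d N z) \<longlonglongrightarrow> L"
  shows "infinite_comp_converges f d z \<and> L = infinite_comp f d z"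
  using assms by (auto simp: infinite_comp_converges_def infinite_comp_def convergentI limI)

theorem proposition1p1:
  fixes z :: complex
  shows "(infinite_comp_converges (\<lambda>n w. w + w ^ 2 / 2 ^ n) 1 z \<and>
          1 / 2 * (exp (2 * z) - 1) = infinite_comp (\<lambda>n w. w + w ^ 2 / 2 ^ n) 1 z) \<and>
         (infinite_comp_converges (\<lambda>n w. w + w ^ 2 / (- 2) ^ n) 1 z \<and>
          sin (2 * z / of_real (sqrt 3) + of_real pi / 6) - 1 / 2
            = infinite_comp (\<lambda>n w. w + w ^ 2 / (- 2) ^ n) 1 z) \<and>
         (infinite_comp_converges (\<lambda>n w. w + w ^ 2 / 4 ^ n) 1 z \<and>
          (sinh (csqrt z)) ^ 2 = infinite_comp (\<lambda>n w. w + w ^ 2 / 4 ^ n) 1 z)"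
proof (intro conjI[of "_ \<and> _"])
  show "infinite_comp_converges (\<lambda>n w. w + w ^ 2 / 2 ^ n) 1 z \<and>
      1 / 2 * (exp (2 * z) - 1) = infinite_comp (\<lambda>n w. w + w ^ 2 / 2 ^ n) 1 z"
    by (rule infinite_comp_eqI[OF quadratic_comp_tendsto_exp])
  show "infinite_comp_converges (\<lambda>n w. w + w ^ 2 / (- 2) ^ n) 1 z \<and>
      sin (2 * z / of_real (sqrt 3) + of_real pi / 6) - 1 / 2
        = infinite_comp (\<lambda>n w. w + w ^ 2 / (- 2) ^ n) 1 z"
    by (rule infinite_comp_eqI[OF quadratic_comp_tendsto_sin])
  show "infinite_comp_converges (\<lambda>n w. w + w ^ 2 / 4 ^ n) 1 z \<and>
      sinh (csqrt z) ^ 2 = infinite_comp (\<lambda>n w. w + w ^ 2 / 4 ^ n) 1 z"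
    using infinite_comp_eqI[OF quadratic_comp_tendsto_sinh[of "csqrt z"]] by simp
qed

end
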